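(* Let $f(x)=\max\{0,f_0-ax\}$ and $g(x)=g_0$ for $x\ge 0$, where $f_0,g_0\in(0,1]$, $a>0$, $c>0$ and $f_0g_0>c$. Every Nash equilibrium $\mathcal{C}(L_C^*,l_d^* )$ with $$l_d^*=\frac{f_0}{a}-\frac{c}{a g_0}<L_C^*,\qquad L_C^*=\frac{L}{N},\ N\ge2 \text{ an integer},$$ is neutral-stable.
   Context: **Model.** $\mathcal{R}=[-L,L)$, $L>0$, with the torus metric $d(x,y)=\|x-y\|=\min\{|x-y|,2L-|x-y|\}$. The set of content-consuming agents is $\mathcal{A}_d=\mathcal{R}$ and the set of content-producing agents is $\mathcal{A}_s=\mathcal{R}$; agents are identified with points $y\in\mathcal R$. Put $p(x|y)=f(d(x,y))$ and $q(x|y)=g(d(x,y))$. Constants: $c>0$ (consumption cost), $0<E_p\le 1$, $E_q>0$. A community is a pair $C=(C_d,C_s)$ with $C_d\subseteq\mathcal{A}_d$, $C_s\subseteq\mathcal{A}_s$. With $\alpha_C(y)$ the fraction of content of $C$ consumed by $y\in C_d$ and $\beta_C(x|y)$ the rate at which $y\in C_s$ produces content on topic $x$ in $C$, the utilities are $$U_C^{(d)}(y)=\alpha_C(y)\int_{\mathcal{R}}[Q_C(x)p(x|y)-\beta_C(x)c]\,dx,\qquad U_C^{(s)}(y)=\int_{\mathcal{R}}\beta_C(x|y)[q(x|y)P_C(x)-\alpha_C c]\,dx,$$ where $Q_C(x)=\int_{C_s}\beta_C(x|y)q(x|y)dy$, $\beta_C(x)=\int_{C_s}\beta_C(x|y)dy$,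 $P_C(x)=\int_{C_d}\alpha_C(y)p(x|y)dy$, $\alpha_C=\int_{C_d}\alpha_C(z)dz$. A community structure is a set $\mathcal{C}$ of communities with allocations $\alpha_{\mathcal C}(y)=\{\alpha_C(y)\}_{C\in\mathcal{C}}$ and $\beta_{\mathcal C}(\cdot|y)=\{\beta_C(\cdot|y)\}_{C\in\mathcal{C}}$ satisfying $\sum_C\alpha_C(y)\le E_p$ and $\sum_C\int_{\mathcal R}\beta_C(x|y)dx\le E_q$. It is a Nash equilibrium if for every $y\in\mathcal{A}_d$ the allocation $\alpha_{\mathcal C}(y)$ maximizes $\sum_C U_C^{(d)}(y)$, and for every $y\in\mathcal{A}_s$ the allocation $\beta_{\mathcal C}(\cdot|y)$ maximizes $\sum_C U_C^{(s)}(y)$, under these constraints. **The family $\mathcal{C}(L_C,l_d)$.** Let $N\ge2$ be an integer, $L_C=L/N$, $0<l_d\le L_C$, and let $m_1,\dots,m_N$ be evenly spaced points in $\mathcal{R}$ with $m_{k+1}=m_1+2L_Ck$. The communities are $C_d^k=[m_k-l_d,m_k+l_d)$, $C_s^k=[m_k-L_C,m_k+L_C)$, $k=1,\dots,N$, with $\alpha_{C^k}(y)=E_p$ for $y\in C_d^k$ and $0$ otherwise, and $\beta_{C^k}(\cdot|y)=E_q\,\delta(x-x^*(y))$ (Dirac delta) for $y\in C^k_s$ and $0$ otherwise, where $x^*(y)=\arg\max_{x\in\mathcal{R}}q(x|y)P_{C^k}(x)$. It is known from earlier work that, for $0<l_d^*<L_C^*=L/N$, $\mathcal{C}(L_C^*,l_d^*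 )$ is a Nash equilibrium if and only if $l_d^*=\frac{f_0}{a}-\frac{c}{ag_0}$. **Perturbation model.** Given a Nash equilibrium $\mathcal{C}(L_C^*,l_d^* )$, write $L_C=L_C^*$ and, by translation, consider two adjacent communities centered at $-L_C$ and $L_C$: $C^1_d=[-L_C-l_d^*,-L_C+l_d^* )$, $C^2_d=[L_C-l_d^*,L_C+l_d^* )$, $C^1_s=[-2L_C,0)$, $C^2_s=[0,2L_C)$. For $t\ge0$ the perturbed communities $C_1(t)=(C_d^1(t),C_s^1(t))$, $C_2(t)=(C_d^2(t),C_s^2(t))$ are $$C_d^1(t)=[-L_C-l_d^*,-L_C+l_d^*+\delta_{dl}(t)),\quad C_d^2(t)=[L_C-l_d^*+\delta_{dr}(t),L_C+l_d^* ),$$ $$C_s^1(t)=[-2L_C,\delta_{sl}(t)),\quad C_s^2(t)=[\delta_{sr}(t),2L_C).$$ Initial perturbations satisfy $\delta_{sl}(0)=\delta_{sr}(0)$, and $\delta_{dl}(0)=\delta_{dr}(0)$ if $l_d^*=L_C$, while $\delta_{dl}(0)<2L_C-2l_d^*+\delta_{dr}(0)$ if $l_d^*<L_C$. For $i=1,2$ let $x_i^*(y,t)=\arg\max_{x\in\mathcal{R}}q(x|y)\int_{C_d^i(t)}p(x|z)dz$; this is the midpoint of $C_d^i(t)$ (which is the chosen maximizer if it is not unique). The utilities are $$U_{C_i(t)}^{(d)}(y)=E_pE_q\int_{C_s^i(t)}[q(x_i^*(z,t)|z)p(x_i^*(z,t)|y)-c]dz,\quad U_{C_i(t)}^{(s)}(y)=E_pE_q\int_{C_d^i(t)}[q(x_i^*(y,t)|y)p(x_i^*(y,t)|z)-c]dz.$$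 The perturbations evolve for $t\ge 0$ by $$\tfrac{d\delta_{dl}}{dt}=U_{C_1(t)}^{(d)}(-L_C+l_d^*+\delta_{dl}(t))-\max\{0,U_{C_2(t)}^{(d)}(-L_C+l_d^*+\delta_{dl}(t))\},$$ $$\tfrac{d\delta_{dr}}{dt}=\max\{0,U_{C_1(t)}^{(d)}(L_C-l_d^*+\delta_{dr}(t))\}-U_{C_2(t)}^{(d)}(L_C-l_d^*+\delta_{dr}(t)),$$ $$\tfrac{d\delta_{sl}}{dt}=U_{C_1(t)}^{(s)}(-L_C+l_d^*+\delta_{sl}(t))-\max\{0,U_{C_2(t)}^{(s)}(-L_C+l_d^*+\delta_{sl}(t))\},$$ $$\tfrac{d\delta_{sr}}{dt}=\max\{0,U_{C_1(t)}^{(s)}(L_C-l_d^*+\delta_{sr}(t))\}-U_{C_2(t)}^{(s)}(L_C-l_d^*+\delta_{sr}(t)).$$ **Neutral-stable.** $\mathcal{C}(L_C^*,l_d^* )$ is neutral-stable if at least one of the following holds. (1) There is $\delta>0$ such that whenever $0<\delta_{dl}(0),\delta_{dr}(0),\delta_{sl}(0),\delta_{sr}(0)\le\delta$ (initial perturbations as in the model), one has $0\le\delta_{dl}(t),\delta_{dr}(t)\le\delta$ for $t\ge0$, $\lim_{t\to\infty}\delta_{dl}(t)=\lim_{t\to\infty}\delta_{dr}(t)=0$, and $\lim_{t\to\infty}U_{C_1(t)}^{(s)}(y)=\lim_{t\to\infty}U_{C_2(t)}^{(s)}(y)>0$ for all $y\in C_s^1\cup C_s^2$. (2) There is $\delta>0$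 such that whenever $0<\delta_{dl}(0),\delta_{dr}(0),\delta_{sl}(0),\delta_{sr}(0)\le\delta$, one has $0\le\delta_{sl}(t),\delta_{sr}(t)\le\delta$ for $t\ge0$, $\lim_{t\to\infty}\delta_{sl}(t)=\lim_{t\to\infty}\delta_{sr}(t)=0$, and $\lim_{t\to\infty}U_{C_1(t)}^{(d)}(y)=\lim_{t\to\infty}U_{C_2(t)}^{(d)}(y)>0$ for all $y\in C_d^1\cup C_d^2$. *)

theory Defs
  imports "HOL-Probability.Probability"
begin

section \<open>Content markets\<close>

text \<open>The fields are the half-length \<open>L\<close> of the torus \<open>[-L, L)\<close>, the functions \<open>f\<close> and \<open>g\<close>
  (only their values on \<open>[0, \<infinity>)\<close> matter), the consumption cost \<open>c\<close> and the budgets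
  \<open>E\<^sub>p\<close> and \<open>E\<^sub>q\<close>.\<close>

record content_model =
  m_L  :: real
  m_f  :: "real \<Rightarrow> real"
  m_g  :: "real \<Rightarrow> real"
  m_c  :: real
  m_Ep :: real
  m_Eq :: real

definition agents :: "content_model \<Rightarrow> real set" where
  "agents M = {- m_L M ..< m_L M}"

definition tdist :: "content_model \<Rightarrow> real \<Rightarrow> real \<Rightarrow> real" where
  "tdist M x y = min \<bar>x - y\<bar> (2 * m_L M - \<bar>x - y\<bar>)"

text \<open>The arguments of \<open>p\<close> and \<open>q\<close> are in the order of the notation \<open>p(x|y)\<close>: topic, then agent.\<close>

definition p :: "content_model \<Rightarrow> real \<Rightarrow> real \<Rightarrow> real" where
  "p M x y = m_f M (tdist M x y)"

definition q :: "content_model \<Rightarrow> real \<Rightarrow> real \<Rightarrow> real" where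
  "q M x y = m_g M (tdist M x y)"

section \<open>Community structures and Nash equilibria\<close>

text \<open>Since production allocations may be Dirac deltas, \<open>\<beta>\<^sub>C(\<cdot>|y)\<close> is a finite Borel measure on
  \<open>[-L, L)\<close>: the expression \<open>\<beta>\<^sub>C(x|y) dx\<close> is read as \<open>\<beta>\<^sub>C(dx|y)\<close>, and the densities
  \<open>Q\<^sub>C\<close> and \<open>\<beta>\<^sub>C\<close> become the measures \<open>quality_measure\<close> and \<open>supply_measure\<close>.\<close>

abbreviation topics :: "content_model \<Rightarrow> real measure" where
  "topics M \<equiv> restrict_space borel (agents M)"

record 'i community_structure =
  comms  :: "'i set"
  C_d    :: "'i \<Rightarrow> real set"
  C_s    :: "'i \<Rightarrow> real set"
  alloc_d :: "'i \<Rightarrow> real \<Rightarrow> real"           \<comment> \<open>\<open>alloc_d k y\<close> is \<open>\<alpha>\<^sub>C(y)\<close> for \<open>C = C\<^sup>k\<close>\<close>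
  alloc_s :: "'i \<Rightarrow> real \<Rightarrow> real measure"   \<comment> \<open>\<open>alloc_s k y\<close> is \<open>\<beta>\<^sub>C(\<cdot>|y)\<close> for \<open>C = C\<^sup>k\<close>\<close>

definition quality_measure ::
    "content_model \<Rightarrow> 'i community_structure \<Rightarrow> 'i \<Rightarrow> real measure" where
  "quality_measure M S k = measure_of (agents M) (sets (topics M))
     (\<lambda>A. \<integral>\<^sup>+ y \<in> C_s S k. (\<integral>\<^sup>+ x \<in> A. ennreal (q M x y) \<partial>alloc_s S k y) \<partial>lborel)"

definition supply_measure ::
    "content_model \<Rightarrow> 'i community_structure \<Rightarrow> 'i \<Rightarrow> real measure" where
  "supply_measure M S k = measure_of (agents M) (sets (topics M))
     (\<lambda>A. \<integral>\<^sup>+ y \<in> C_s S k. emeasure (alloc_s S k y) A \<partial>lborel)"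

text \<open>\<open>demand M D \<alpha>\<close> is the function \<open>P\<^sub>C\<close> of a community with consumers \<open>D\<close>.\<close>

definition demand :: "content_model \<Rightarrow> real set \<Rightarrow> (real \<Rightarrow> real) \<Rightarrow> real \<Rightarrow> real" where
  "demand M D \<alpha> x = (LBINT y:D. \<alpha> y * p M x y)"

definition total_attention :: "real set \<Rightarrow> (real \<Rightarrow> real) \<Rightarrow> real" where
  "total_attention D \<alpha> = (LBINT y:D. \<alpha> y)"

text \<open>The own allocation (\<open>a\<close>, resp. \<open>b\<close>) of agent \<open>y\<close> is a separate argument, so that the
  utilities can be evaluated at unilateral deviations.\<close>

definition U_d :: "content_model \<Rightarrow> 'i community_structure \<Rightarrow> 'i \<Rightarrow> real \<Rightarrow> real \<Rightarrow> real" where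
  "U_d M S k y a = a * ((LINT x|quality_measure M S k. p M x y)
                        - m_c M * measure (supply_measure M S k) (agents M))"

definition U_s ::
    "content_model \<Rightarrow> 'i community_structure \<Rightarrow> 'i \<Rightarrow> real \<Rightarrow> real measure \<Rightarrow> real" where
  "U_s M S k y b = (LINT x|b. q M x y * demand M (C_d S k) (alloc_d S k) x
                              - total_attention (C_d S k) (alloc_d S k) * m_c M)"

definition feasible_d :: "content_model \<Rightarrow> 'i set \<Rightarrow> ('i \<Rightarrow> real) \<Rightarrow> bool" where
  "feasible_d M K a \<longleftrightarrow> (\<forall>k\<in>K. 0 \<le> a k) \<and> (\<Sum>k\<in>K. a k) \<le> m_Ep M"

definition feasible_s :: "content_model \<Rightarrow> 'i set \<Rightarrow> ('i \<Rightarrow> real measure) \<Rightarrow> bool" where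
  "feasible_s M K b \<longleftrightarrow> (\<forall>k\<in>K. sets (b k) = sets (topics M)) \<and>
     (\<Sum>k\<in>K. emeasure (b k) (agents M)) \<le> ennreal (m_Eq M)"

definition community_structure :: "content_model \<Rightarrow> 'i community_structure \<Rightarrow> bool" where
  "community_structure M S \<longleftrightarrow>
     finite (comms S) \<and>
     (\<forall>k\<in>comms S. C_d S k \<subseteq> agents M \<and> C_s S k \<subseteq> agents M \<and>
        C_d S k \<in> sets borel \<and> C_s S k \<in> sets borel \<and>
        alloc_d S k \<in> borel_measurable (topics M) \<and>
        (\<forall>A\<in>sets (topics M).
           (\<lambda>y. emeasure (alloc_s S k y) A) \<in> borel_measurable (topics M))) \<and>
     (\<forall>y\<in>agents M. feasible_d M (comms S) (\<lambda>k. alloc_d S k y)) \<and>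
     (\<forall>y\<in>agents M. feasible_s M (comms S) (\<lambda>k. alloc_s S k y))"

text \<open>Agents may deviate to any community of the structure, including those they do not belong to.\<close>

definition nash_equilibrium :: "content_model \<Rightarrow> 'i community_structure \<Rightarrow> bool" where
  "nash_equilibrium M S \<longleftrightarrow> community_structure M S \<and>
     (\<forall>y\<in>agents M. \<forall>a. feasible_d M (comms S) a \<longrightarrow>
        (\<Sum>k\<in>comms S. U_d M S k y (a k)) \<le> (\<Sum>k\<in>comms S. U_d M S k y (alloc_d S k y))) \<and>
     (\<forall>y\<in>agents M. \<forall>b. feasible_s M (comms S) b \<longrightarrow>
        (\<Sum>k\<in>comms S. U_s M S k y (b k)) \<le> (\<Sum>k\<in>comms S. U_s M S k y (alloc_s S k y)))"

section \<open>The family \<open>\<C>(L\<^sub>C, l\<^sub>d)\<close>\<close>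

text \<open>An arc \<open>[m - r, m + r)\<close> of the torus, as a subset of \<open>[-L, L)\<close>.\<close>

definition wrap :: "content_model \<Rightarrow> real \<Rightarrow> real" where
  "wrap M x = x - 2 * m_L M * of_int \<lfloor>(x + m_L M) / (2 * m_L M)\<rfloor>"

definition arc :: "content_model \<Rightarrow> real \<Rightarrow> real \<Rightarrow> real set" where
  "arc M m r = wrap M ` {m - r ..< m + r}"

text \<open>The communities are indexed by \<open>0, \<dots>, N - 1\<close>; \<open>m0\<close> is the first of the \<open>N\<close> centers.\<close>

definition family_consumption ::
    "content_model \<Rightarrow> real \<Rightarrow> real \<Rightarrow> real \<Rightarrow> nat \<Rightarrow> real \<Rightarrow> real" where
  "family_consumption M m0 LC ld k y =
     (if y \<in> arc M (m0 + 2 * LC * real k) ld then m_Ep M else 0)"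

definition family_topic :: "content_model \<Rightarrow> real \<Rightarrow> real \<Rightarrow> real \<Rightarrow> nat \<Rightarrow> real \<Rightarrow> real" where
  "family_topic M m0 LC ld k y =
     arg_max_on (\<lambda>x. q M x y * demand M (arc M (m0 + 2 * LC * real k) ld)
                                        (family_consumption M m0 LC ld k) x) (agents M)"

definition family_production ::
    "content_model \<Rightarrow> real \<Rightarrow> real \<Rightarrow> real \<Rightarrow> nat \<Rightarrow> real \<Rightarrow> real measure" where
  "family_production M m0 LC ld k y =
     (if y \<in> arc M (m0 + 2 * LC * real k) LC
      then scale_measure (ennreal (m_Eq M)) (return (topics M) (family_topic M m0 LC ld k y))
      else null_measure (topics M))"

definition community_family ::
    "content_model \<Rightarrow> nat \<Rightarrow> real \<Rightarrow> real \<Rightarrow> real \<Rightarrow> nat community_structure" where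
  "community_family M N m0 LC ld =
     \<lparr> comms = {..<N},
       C_d = (\<lambda>k. arc M (m0 + 2 * LC * real k) ld),
       C_s = (\<lambda>k. arc M (m0 + 2 * LC * real k) LC),
       alloc_d = family_consumption M m0 LC ld,
       alloc_s = family_production M m0 LC ld \<rparr>"

section \<open>Perturbations and neutral stability\<close>

text \<open>The four boundary perturbations \<open>\<delta>\<^sub>d\<^sub>l\<close>, \<open>\<delta>\<^sub>d\<^sub>r\<close>, \<open>\<delta>\<^sub>s\<^sub>l\<close>, \<open>\<delta>\<^sub>s\<^sub>r\<close> as functions of time.\<close>

record perturbation =
  \<delta>dl :: "real \<Rightarrow> real"
  \<delta>dr :: "real \<Rightarrow> real"
  \<delta>sl :: "real \<Rightarrow> real"
  \<delta>sr :: "real \<Rightarrow> real"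

datatype side = Com1 | Com2

text \<open>Endpoints \<open>(u, v)\<close> of the intervals \<open>[u, v)\<close> forming the two perturbed communities.\<close>

fun ends_d :: "real \<Rightarrow> real \<Rightarrow> perturbation \<Rightarrow> side \<Rightarrow> real \<Rightarrow> real \<times> real" where
  "ends_d LC ld \<delta> Com1 t = (- LC - ld, - LC + ld + \<delta>dl \<delta> t)"
| "ends_d LC ld \<delta> Com2 t = (LC - ld + \<delta>dr \<delta> t, LC + ld)"

fun ends_s :: "real \<Rightarrow> perturbation \<Rightarrow> side \<Rightarrow> real \<Rightarrow> real \<times> real" where
  "ends_s LC \<delta> Com1 t = (- 2 * LC, \<delta>sl \<delta> t)"
| "ends_s LC \<delta> Com2 t = (\<delta>sr \<delta> t, 2 * LC)"

definition pert_C_d :: "real \<Rightarrow> real \<Rightarrow> perturbation \<Rightarrow> side \<Rightarrow> real \<Rightarrow> real set" where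
  "pert_C_d LC ld \<delta> i t = {fst (ends_d LC ld \<delta> i t) ..< snd (ends_d LC ld \<delta> i t)}"

definition pert_C_s :: "real \<Rightarrow> perturbation \<Rightarrow> side \<Rightarrow> real \<Rightarrow> real set" where
  "pert_C_s LC \<delta> i t = {fst (ends_s LC \<delta> i t) ..< snd (ends_s LC \<delta> i t)}"

text \<open>The maximizer \<open>x\<^sub>i\<^sup>*(y, t)\<close>; ties are broken in favour of the midpoint of \<open>C\<^sub>d\<^sup>i(t)\<close>.\<close>

definition pert_topic ::
    "content_model \<Rightarrow> real \<Rightarrow> real \<Rightarrow> perturbation \<Rightarrow> side \<Rightarrow> real \<Rightarrow> real \<Rightarrow> real" where
  "pert_topic M LC ld \<delta> i t y =
     (let F = (\<lambda>x. q M x y * (LBINT z:pert_C_d LC ld \<delta> i t. p M x z));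
          m = midpoint (fst (ends_d LC ld \<delta> i t)) (snd (ends_d LC ld \<delta> i t))
      in if is_arg_max F (\<lambda>x. x \<in> agents M) m then m else arg_max_on F (agents M))"

definition pert_U_d ::
    "content_model \<Rightarrow> real \<Rightarrow> real \<Rightarrow> perturbation \<Rightarrow> side \<Rightarrow> real \<Rightarrow> real \<Rightarrow> real" where
  "pert_U_d M LC ld \<delta> i t y = m_Ep M * m_Eq M *
     (LBINT z:pert_C_s LC \<delta> i t.
        q M (pert_topic M LC ld \<delta> i t z) z * p M (pert_topic M LC ld \<delta> i t z) y - m_c M)"

definition pert_U_s ::
    "content_model \<Rightarrow> real \<Rightarrow> real \<Rightarrow> perturbation \<Rightarrow> side \<Rightarrow> real \<Rightarrow> real \<Rightarrow> real" where
  "pert_U_s M LC ld \<delta> i t y = m_Ep M * m_Eq M *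
     (LBINT z:pert_C_d LC ld \<delta> i t.
        q M (pert_topic M LC ld \<delta> i t y) y * p M (pert_topic M LC ld \<delta> i t y) z - m_c M)"

definition admissible_initial :: "real \<Rightarrow> real \<Rightarrow> perturbation \<Rightarrow> bool" where
  "admissible_initial LC ld \<delta> \<longleftrightarrow>
     \<delta>sl \<delta> 0 = \<delta>sr \<delta> 0 \<and>
     (ld = LC \<longrightarrow> \<delta>dl \<delta> 0 = \<delta>dr \<delta> 0) \<and>
     (ld < LC \<longrightarrow> \<delta>dl \<delta> 0 < 2 * LC - 2 * ld + \<delta>dr \<delta> 0)"

text \<open>The evolution for \<open>t \<ge> 0\<close>; at \<open>t = 0\<close> the derivative is the right derivative. The producer
  equations evaluate the utilities at \<open>\<mp>(L\<^sub>C - l\<^sub>d)\<close> plus the perturbation, as for consumers.\<close>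

definition evolves :: "content_model \<Rightarrow> real \<Rightarrow> real \<Rightarrow> perturbation \<Rightarrow> bool" where
  "evolves M LC ld \<delta> \<longleftrightarrow> (\<forall>t\<ge>0.
     (\<delta>dl \<delta> has_real_derivative
        pert_U_d M LC ld \<delta> Com1 t (- LC + ld + \<delta>dl \<delta> t)
        - max 0 (pert_U_d M LC ld \<delta> Com2 t (- LC + ld + \<delta>dl \<delta> t))) (at t within {0..}) \<and>
     (\<delta>dr \<delta> has_real_derivative
        max 0 (pert_U_d M LC ld \<delta> Com1 t (LC - ld + \<delta>dr \<delta> t))
        - pert_U_d M LC ld \<delta> Com2 t (LC - ld + \<delta>dr \<delta> t)) (at t within {0..}) \<and>
     (\<delta>sl \<delta> has_real_derivative
        pert_U_s M LC ld \<delta> Com1 t (- LC + ld + \<delta>sl \<delta> t)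
        - max 0 (pert_U_s M LC ld \<delta> Com2 t (- LC + ld + \<delta>sl \<delta> t))) (at t within {0..}) \<and>
     (\<delta>sr \<delta> has_real_derivative
        max 0 (pert_U_s M LC ld \<delta> Com1 t (LC - ld + \<delta>sr \<delta> t))
        - pert_U_s M LC ld \<delta> Com2 t (LC - ld + \<delta>sr \<delta> t)) (at t within {0..}))"

definition small_initial :: "real \<Rightarrow> perturbation \<Rightarrow> bool" where
  "small_initial \<epsilon> \<delta> \<longleftrightarrow>
     0 < \<delta>dl \<delta> 0 \<and> \<delta>dl \<delta> 0 \<le> \<epsilon> \<and> 0 < \<delta>dr \<delta> 0 \<and> \<delta>dr \<delta> 0 \<le> \<epsilon> \<and>
     0 < \<delta>sl \<delta> 0 \<and> \<delta>sl \<delta> 0 \<le> \<epsilon> \<and> 0 < \<delta>sr \<delta> 0 \<and> \<delta>sr \<delta> 0 \<le> \<epsilon>"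

definition neutral_stable_d :: "content_model \<Rightarrow> real \<Rightarrow> real \<Rightarrow> bool" where
  "neutral_stable_d M LC ld \<longleftrightarrow> (\<exists>\<epsilon>>0. \<forall>\<delta>.
     evolves M LC ld \<delta> \<and> admissible_initial LC ld \<delta> \<and> small_initial \<epsilon> \<delta> \<longrightarrow>
       (\<forall>t\<ge>0. 0 \<le> \<delta>dl \<delta> t \<and> \<delta>dl \<delta> t \<le> \<epsilon> \<and> 0 \<le> \<delta>dr \<delta> t \<and> \<delta>dr \<delta> t \<le> \<epsilon>) \<and>
       (\<delta>dl \<delta> \<longlongrightarrow> 0) at_top \<and> (\<delta>dr \<delta> \<longlongrightarrow> 0) at_top \<and>
       (\<forall>y \<in> {- 2 * LC ..< 0} \<union> {0 ..< 2 * LC}. \<exists>u>0.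
          ((\<lambda>t. pert_U_s M LC ld \<delta> Com1 t y) \<longlongrightarrow> u) at_top \<and>
          ((\<lambda>t. pert_U_s M LC ld \<delta> Com2 t y) \<longlongrightarrow> u) at_top))"

definition neutral_stable_s :: "content_model \<Rightarrow> real \<Rightarrow> real \<Rightarrow> bool" where
  "neutral_stable_s M LC ld \<longleftrightarrow> (\<exists>\<epsilon>>0. \<forall>\<delta>.
     evolves M LC ld \<delta> \<and> admissible_initial LC ld \<delta> \<and> small_initial \<epsilon> \<delta> \<longrightarrow>
       (\<forall>t\<ge>0. 0 \<le> \<delta>sl \<delta> t \<and> \<delta>sl \<delta> t \<le> \<epsilon> \<and> 0 \<le> \<delta>sr \<delta> t \<and> \<delta>sr \<delta> t \<le> \<epsilon>) \<and>
       (\<delta>sl \<delta> \<longlongrightarrow> 0) at_top \<and> (\<delta>sr \<delta> \<longlongrightarrow> 0) at_top \<and>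
       (\<forall>y \<in> {- LC - ld ..< - LC + ld} \<union> {LC - ld ..< LC + ld}. \<exists>u>0.
          ((\<lambda>t. pert_U_d M LC ld \<delta> Com1 t y) \<longlongrightarrow> u) at_top \<and>
          ((\<lambda>t. pert_U_d M LC ld \<delta> Com2 t y) \<longlongrightarrow> u) at_top))"

definition neutral_stable :: "content_model \<Rightarrow> real \<Rightarrow> real \<Rightarrow> bool" where
  "neutral_stable M LC ld \<longleftrightarrow> neutral_stable_d M LC ld \<or> neutral_stable_s M LC ld"

end

theory Submission
  imports Defs
begin

text \<open>Since \<open>q\<close> is constant, producers only care about how many consumers a topic reaches.
  Among all topics, the midpoint of the arc of consumers reaches most of them
  (\<open>reach_le\<close>, \<open>reach_midpoint\<close>), so as long as the perturbation is small every producer of a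
  community serves that midpoint. All utilities then become explicit.

  A consumer at distance \<open>r\<close> from the topic gains \<open>E\<^sub>p E\<^sub>q g\<^sub>0 a (l\<^sub>d - r)\<close> per producer, unless
  \<open>r\<close> is so large that \<open>p\<close> is truncated, because \<open>l\<^sub>d\<close> is the distance at which consumption breaks
  even. Extending the right end of the
  consumers of the first community by \<open>\<delta>\<^sub>d\<^sub>l\<close> moves the midpoint by only half as much, so the
  boundary consumer is at distance \<open>l\<^sub>d + \<delta>\<^sub>d\<^sub>l / 2\<close> and loses; the topic of the other community is
  too far away to attract this consumer. By the same computation the boundary consumer of the
  second community gains, and that community grows back. With \<open>\<rho> = E\<^sub>p E\<^sub>q g\<^sub>0 a\<close>, called \<open>rate\<close>
  below, this gives
  \<open>\<delta>\<^sub>d\<^sub>l' = - \<rho>/2 (2 L\<^sub>C + \<delta>\<^sub>s\<^sub>l) \<delta>\<^sub>d\<^sub>l\<close> and \<open>\<delta>\<^sub>d\<^sub>r' = - \<rho>/2 (2 L\<^sub>C - \<delta>\<^sub>s\<^sub>r) \<delta>\<^sub>d\<^sub>r\<close>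
  (\<open>consumer_drift\<close>): both consumer boundaries return exponentially fast, provided that the
  producer boundaries stay within \<open>L\<^sub>C\<close> of \<open>0\<close>.

  A producer earns the same everywhere in a community, namely \<open>\<rho> (l\<^sub>d\<^sup>2 - \<delta>\<^sub>d\<^sub>l\<^sup>2/4)\<close> in the
  first and \<open>\<rho> (l\<^sub>d\<^sup>2 - \<delta>\<^sub>d\<^sub>r\<^sup>2/4)\<close> in the second, so the producer boundaries move at the speed
  \<open>\<rho>/4 (\<delta>\<^sub>d\<^sub>r\<^sup>2 - \<delta>\<^sub>d\<^sub>l\<^sup>2)\<close> (\<open>producer_drift\<close>). Nothing pulls them back, but this speed is
  of second order and exponentially decaying, hence the total displacement is a small fraction
  of the initial perturbation. Each half of the argument presupposes the other; a continuation
  argument (\<open>near_forever\<close>) closes the circle. In the limit producers earn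
  \<open>\<rho> l\<^sub>d\<^sup>2 > 0\<close> in both communities, which is the first alternative in the definition of
  neutral stability.\<close>

section \<open>Integrals of tent functions\<close>

definition tent :: "real \<Rightarrow> real \<Rightarrow> real" where
  "tent h s = max 0 (h - \<bar>s\<bar>)"

lemma tent_nonneg: "0 \<le> tent h s"
  by (simp add: tent_def)

lemma continuous_on_tent [continuous_intros]:
  "continuous_on S w \<Longrightarrow> continuous_on S (\<lambda>z. tent h (w z))"
  unfolding tent_def by (intro continuous_intros)

lemma tent_integrable: "tent h integrable_on {u..v}"
  by (intro integrable_continuous_real continuous_intros)

lemma has_integral_tent:
  assumes "0 \<le> h" "u \<le> - h" "h \<le> v"
  shows "(tent h has_integral h\<^sup>2) {u..v}"
proof -
  have "((\<lambda>s. h + s) has_integral (h * 0 + 0\<^sup>2 / 2) - (h * (- h) + (- h)\<^sup>2 / 2)) {- h..0}"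
    by (intro fundamental_theorem_of_calculus)
      (use assms in \<open>auto simp flip: has_real_derivative_iff_has_vector_derivative
         intro!: derivative_eq_intros\<close>)
  then have left: "(tent h has_integral h\<^sup>2 / 2) {- h..0}"
    by (rule has_integral_eq_rhs[OF has_integral_eq, rotated])
      (use assms in \<open>auto simp: tent_def field_simps power2_eq_square\<close>)
  have "((\<lambda>s. h - s) has_integral (h * h - h\<^sup>2 / 2) - (h * 0 - 0\<^sup>2 / 2)) {0..h}"
    by (intro fundamental_theorem_of_calculus)
      (use assms in \<open>auto simp flip: has_real_derivative_iff_has_vector_derivative
         intro!: derivative_eq_intros\<close>)
  then have right: "(tent h has_integral h\<^sup>2 / 2) {0..h}"
    by (rule has_integral_eq_rhs[OF has_integral_eq, rotated])
      (use assms in \<open>auto simp: tent_def field_simps power2_eq_square\<close>)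
  have "(tent h has_integral h\<^sup>2) {- h..h}"
    using has_integral_combine[OF _ _ left right] assms by simp
  then show ?thesis
    by (rule has_integral_on_superset) (use assms in \<open>auto simp: tent_def\<close>)
qed

lemma integral_tent_shift:
  "integral {u..v} (\<lambda>z. tent h (z + b)) = integral {u + b..v + b} (tent h)"
  using integral_shift_Icc_real[of u v "tent h" b] by (simp add: o_def add.commute)

text \<open>The summands are translates of one tent, so the three integrals are integrals of the tent
  itself over the translates of the interval by \<open>- x - P\<close>, \<open>- x\<close> and \<open>- x + P\<close>. An interval no longer than \<open>P\<close> has
  non-overlapping translates, and together they cannot collect more than the whole mass.\<close>

lemma integral_tent_periodised:
  assumes "0 \<le> h" "u \<le> v" "v - u \<le> P"
  shows "integral {u..v} (\<lambda>z. tent h (z - x - P) + tent h (z - x) + tent h (z - x + P)) \<le> h\<^sup>2"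
proof -
  let ?I = "\<lambda>s t. integral {s..t} (tent h)"
  define B where "B = h + \<bar>u - x - P\<bar> + \<bar>v - x + P\<bar>"
  have combine: "?I s t + ?I t w = ?I s w" if "s \<le> t" "t \<le> w" for s t w
    using Henstock_Kurzweil_Integration.integral_combine[OF that tent_integrable] .
  have nonneg: "0 \<le> ?I s t" for s t
    by (intro integral_nonneg tent_integrable tent_nonneg)
  have "integral {u..v} (\<lambda>z. tent h (z - x - P) + tent h (z - x) + tent h (z - x + P))
      = integral {u..v} (\<lambda>z. tent h (z + (- x - P))) + integral {u..v} (\<lambda>z. tent h (z + (- x)))
        + integral {u..v} (\<lambda>z. tent h (z + (- x + P)))"
    by (subst integral_add[symmetric]; (intro integrable_continuous_real continuous_intros)?)+
       (simp add: algebra_simps)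
  also have "\<dots> = ?I (u - x - P) (v - x - P) + ?I (u - x) (v - x) + ?I (u - x + P) (v - x + P)"
    by (simp only: integral_tent_shift) (simp add: algebra_simps)
  also have "\<dots> \<le> ?I (u - x - P) (v - x + P)"
    using combine[of "u - x - P" "v - x - P" "u - x"] nonneg[of "v - x - P" "u - x"]
      combine[of "u - x - P" "u - x" "v - x"] combine[of "u - x - P" "v - x" "u - x + P"]
      nonneg[of "v - x" "u - x + P"] combine[of "u - x - P" "u - x + P" "v - x + P"] assms
    by linarith
  also have "\<dots> \<le> ?I (- B) B"
    by (intro integral_subset_le tent_integrable tent_nonneg ballI)
      (use assms in \<open>auto simp: B_def\<close>)
  also have "\<dots> = h\<^sup>2"
    using has_integral_tent[of h "- B" B] assms by (simp add: B_def integral_unique)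
  finally show ?thesis .
qed

lemma LBINT_Ico_eq_integral:
  fixes f :: "real \<Rightarrow> real"
  assumes "u \<le> v" "continuous_on {u..v} f"
  shows "(LBINT z:{u..<v}. f z) = integral {u..v} f"
  using interval_integral_Ico[of u v f] interval_integral_Icc[OF assms(1), of f]
    set_borel_integral_eq_integral(2)[OF borel_integrable_atLeastAtMost'[OF assms(2)]] assms(1)
  by simp

section \<open>Decay and drift of trajectories\<close>

lemma has_derivative_interior:
  fixes x :: "real \<Rightarrow> real"
  assumes "(x has_real_derivative d) (at t within {0..})" "0 < t"
  shows "(x has_real_derivative d) (at t)"
proof -
  have "at t within {0..} = at t"
    using assms(2) by (intro at_within_interior) simp
  with assms(1) show ?thesis by simp
qed

lemma continuous_on_differentiable_path:
  fixes x :: "real \<Rightarrow> real"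
  assumes "\<And>t. \<lbrakk>0 \<le> t; t \<le> T\<rbrakk> \<Longrightarrow> \<exists>d. (x has_real_derivative d) (at t within {0..})"
  shows "continuous_on {0..T} x"
  unfolding continuous_on_eq_continuous_within
proof
  fix t assume "t \<in> {0..T}"
  then have "continuous (at t within {0..}) x"
    using assms[of t] DERIV_continuous by auto
  then show "continuous (at t within {0..T}) x"
    by (rule continuous_within_subset) auto
qed

text \<open>The energy \<open>x\<^sup>2\<close> satisfies \<open>(x\<^sup>2)' = - 2 k x\<^sup>2\<close> whatever the sign of \<open>x\<close>. The upper bound
  on \<open>k\<close> therefore keeps \<open>x\<close> away from \<open>0\<close>, hence positive by continuity, and the lower bound on
  \<open>k\<close> makes it decay.\<close>

lemma exponential_decay:
  fixes x k :: "real \<Rightarrow> real"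
  assumes T: "0 \<le> T"
    and deriv: "\<And>t. \<lbrakk>0 \<le> t; t \<le> T\<rbrakk> \<Longrightarrow> (x has_real_derivative - (k t * x t)) (at t within {0..})"
    and bounds: "\<And>t. \<lbrakk>0 \<le> t; t \<le> T\<rbrakk> \<Longrightarrow> \<kappa> \<le> k t \<and> k t \<le> \<kappa>'"
    and pos: "0 < x 0"
    and t: "0 \<le> t" "t \<le> T"
  shows "0 < x t \<and> x t \<le> x 0 * exp (- \<kappa> * t)"
proof -
  have cont: "continuous_on {0..T} x"
    by (rule continuous_on_differentiable_path) (use deriv in blast)
  have energy_deriv: "((\<lambda>t. (x t)\<^sup>2 * exp (2 * m * t)) has_real_derivative
      2 * (m - k s) * ((x s)\<^sup>2 * exp (2 * m * s))) (at s)" if "0 < s" "s < T" for s m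
  proof -
    have "(x has_real_derivative - (k s * x s)) (at s)"
      using has_derivative_interior[OF deriv] that by simp
    then show ?thesis
      by (auto intro!: derivative_eq_intros simp: algebra_simps power2_eq_square)
  qed
  have energy_cont: "continuous_on {0..s} (\<lambda>t. (x t)\<^sup>2 * exp (2 * m * t))" if "s \<le> T" for s m
    by (intro continuous_intros continuous_on_subset[OF cont]) (use that in auto)
  have lower: "(x 0)\<^sup>2 \<le> (x s)\<^sup>2 * exp (2 * \<kappa>' * s)" if s: "0 \<le> s" "s \<le> T" for s
  proof -
    have "(x 0)\<^sup>2 * exp (2 * \<kappa>' * 0) \<le> (x s)\<^sup>2 * exp (2 * \<kappa>' * s)"
    proof (rule DERIV_nonneg_imp_increasing_open[OF s(1) _ energy_cont[OF s(2)]])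
      fix r assume "0 < r" "r < s"
      with s bounds[of r] energy_deriv[of r "\<kappa>'"] show
        "\<exists>y. ((\<lambda>t. (x t)\<^sup>2 * exp (2 * \<kappa>' * t)) has_real_derivative y) (at r) \<and> 0 \<le> y"
        by fastforce
    qed
    then show ?thesis by simp
  qed
  have upper: "(x s)\<^sup>2 * exp (2 * \<kappa> * s) \<le> (x 0)\<^sup>2" if s: "0 \<le> s" "s \<le> T" for s
  proof -
    have "(x s)\<^sup>2 * exp (2 * \<kappa> * s) \<le> (x 0)\<^sup>2 * exp (2 * \<kappa> * 0)"
    proof (rule DERIV_nonpos_imp_decreasing_open[OF s(1) _ energy_cont[OF s(2)]])
      fix r assume "0 < r" "r < s"
      with s bounds[of r] energy_deriv[of r \<kappa>] show
        "\<exists>y. ((\<lambda>t. (x t)\<^sup>2 * exp (2 * \<kappa> * t)) has_real_derivative y) (at r) \<and> y \<le> 0"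
        by (fastforce intro: mult_nonpos_nonneg)
    qed
    then show ?thesis by simp
  qed
  have nonzero: "x s \<noteq> 0" if "0 \<le> s" "s \<le> T" for s
    using lower[OF that] pos by auto
  have "0 < x t"
  proof (rule ccontr)
    assume "\<not> 0 < x t"
    then obtain s where "0 \<le> s" "s \<le> t" "x s = 0"
      using IVT2'[of x t 0 0] pos t continuous_on_subset[OF cont, of "{0..t}"] by force
    with nonzero t show False by auto
  qed
  moreover have "(x t * exp (\<kappa> * t))\<^sup>2 \<le> (x 0)\<^sup>2"
    using upper[OF t] by (simp add: power_mult_distrib mult.assoc flip: exp_double)
  then have "x t * exp (\<kappa> * t) \<le> x 0"
    using pos power2_le_imp_le by fastforce
  ultimately show ?thesis
    by (simp add: exp_minus field_simps)
qed

text \<open>At the first time that \<open>r\<close> reaches \<open>\<eta>\<close>, the hypothesis \<open>improve\<close> would apply and contradict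
  \<open>r = \<eta>\<close>.\<close>

lemma bounded_by_continuation:
  fixes r :: "real \<Rightarrow> real"
  assumes cont: "continuous_on {0..} r"
    and start: "r 0 < \<eta>"
    and improve: "\<And>T. \<lbrakk>0 \<le> T; \<And>t. \<lbrakk>0 \<le> t; t \<le> T\<rbrakk> \<Longrightarrow> r t \<le> \<eta>\<rbrakk> \<Longrightarrow> r T < \<eta>"
    and t: "0 \<le> t"
  shows "r t < \<eta>"
proof (rule ccontr)
  assume "\<not> r t < \<eta>"
  define E where "E = {s \<in> {0..t}. \<eta> \<le> r s}"
  have "closed E"
    unfolding E_def
    by (intro continuous_on_closed_Collect_le continuous_intros continuous_on_subset[OF cont]) auto
  then have "compact E"
    using compact_Icc[of 0 t]
    by (metis (no_types, lifting) E_def compact_Int_closed inf.absorb2 mem_Collect_eq subsetI)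
  moreover have "t \<in> E"
    using t \<open>\<not> r t < \<eta>\<close> by (simp add: E_def)
  ultimately obtain T where T: "T \<in> E" and least: "\<And>s. s \<in> E \<Longrightarrow> T \<le> s"
    using compact_attains_inf[of E] by blast
  obtain s where s: "0 \<le> s" "s \<le> T" "r s = \<eta>"
    using IVT'[of r 0 \<eta> T] start T continuous_on_subset[OF cont, of "{0..T}"]
    by (force simp: E_def)
  with least[of s] T have "r T = \<eta>"
    by (auto simp: E_def)
  have "r T < \<eta>"
  proof (rule improve)
    show "0 \<le> T" using T by (simp add: E_def)
    fix s' assume "0 \<le> s'" "s' \<le> T"
    then show "r s' \<le> \<eta>"
      using least[of s'] \<open>r T = \<eta>\<close> T by (cases "s' = T") (force simp: E_def)+
  qed
  with \<open>r T = \<eta>\<close> show False by simp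
qed

text \<open>The speed bound integrates to \<open>D / m (1 - exp (- m T))\<close>.\<close>

lemma bounded_drift:
  fixes x :: "real \<Rightarrow> real"
  assumes T: "0 \<le> T" and m: "0 < m" and D: "0 \<le> D"
    and deriv: "\<And>t. \<lbrakk>0 \<le> t; t \<le> T\<rbrakk> \<Longrightarrow>
      \<exists>d. (x has_real_derivative d) (at t within {0..}) \<and> \<bar>d\<bar> \<le> D * exp (- m * t)"
  shows "\<bar>x T - x 0\<bar> \<le> D / m"
proof -
  have cont: "continuous_on {0..T} x"
    by (rule continuous_on_differentiable_path) (use deriv in blast)
  have one_sided: "s * (x T - x 0) \<le> D / m" if s: "\<bar>s\<bar> = 1" for s
  proof -
    let ?w = "\<lambda>t. D / m * (1 - exp (- m * t)) - s * x t"
    have "?w 0 \<le> ?w T"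
    proof (rule DERIV_nonneg_imp_increasing_open[OF T])
      show "continuous_on {0..T} ?w"
        by (intro continuous_intros cont)
      fix t assume t: "0 < t" "t < T"
      then obtain d where d: "(x has_real_derivative d) (at t within {0..})"
          "\<bar>d\<bar> \<le> D * exp (- m * t)"
        using deriv[of t] by auto
      have "(?w has_real_derivative D * exp (- m * t) - s * d) (at t)"
        using m by (auto intro!: derivative_eq_intros has_derivative_interior[OF d(1) t(1)])
      moreover have "s * d \<le> \<bar>d\<bar>"
        using s abs_ge_self[of "s * d"] by (simp add: abs_mult)
      ultimately show "\<exists>y. (?w has_real_derivative y) (at t) \<and> 0 \<le> y"
        using d(2) by (intro exI[of _ "D * exp (- m * t) - s * d"]) simp
    qed
    then have "s * (x T - x 0) \<le> D / m * (1 - exp (- m * T))"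
      by (simp add: algebra_simps)
    also have "\<dots> \<le> D / m * 1"
      using D m by (intro mult_left_mono) auto
    finally show ?thesis by simp
  qed
  show ?thesis
    using one_sided[of 1] one_sided[of "- 1"] by auto
qed

section \<open>The midpoint of an arc reaches most consumers\<close>

text \<open>The identity \<open>break_even\<close> characterises \<open>l\<^sub>d\<close> as the distance to the topic at which
  the benefit of consumption equals its cost.\<close>

locale linear_market =
  fixes M :: content_model and f0 g0 a LC ld :: real
  assumes cost_pos: "0 < m_c M" and Ep_pos: "0 < m_Ep M" and Eq_pos: "0 < m_Eq M"
    and g0_pos: "0 < g0" and a_pos: "0 < a"
    and f_linear: "\<And>x. 0 \<le> x \<Longrightarrow> m_f M x = max 0 (f0 - a * x)"
    and g_const: "\<And>x. 0 \<le> x \<Longrightarrow> m_g M x = g0"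
    and ld_pos: "0 < ld" and ld_less: "ld < LC" and two_LC_le: "2 * LC \<le> m_L M"
    and break_even: "g0 * (f0 - a * ld) = m_c M"
begin

lemma L_pos: "0 < m_L M"
  using ld_pos ld_less two_LC_le by linarith

lemma tdist_nonneg: "\<lbrakk>\<bar>x\<bar> \<le> m_L M; \<bar>y\<bar> \<le> m_L M\<rbrakk> \<Longrightarrow> 0 \<le> tdist M x y"
  by (auto simp: tdist_def)

lemma p_eq: "\<lbrakk>\<bar>x\<bar> \<le> m_L M; \<bar>y\<bar> \<le> m_L M\<rbrakk> \<Longrightarrow> p M x y = max 0 (f0 - a * tdist M x y)"
  by (simp add: p_def f_linear tdist_nonneg)

lemma q_eq: "\<lbrakk>\<bar>x\<bar> \<le> m_L M; \<bar>y\<bar> \<le> m_L M\<rbrakk> \<Longrightarrow> q M x y = g0"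
  by (simp add: q_def g_const tdist_nonneg)

lemma continuous_on_p:
  assumes "\<bar>x\<bar> \<le> m_L M" "- m_L M \<le> u" "v \<le> m_L M"
  shows "continuous_on {u..v} (p M x)"
proof -
  have "continuous_on {u..v} (\<lambda>z. max 0 (f0 - a * tdist M x z))"
    unfolding tdist_def by (intro continuous_intros)
  then show ?thesis
    by (rule continuous_on_cong[THEN iffD1, rotated -1]) (use assms in \<open>auto simp: p_eq\<close>)
qed

text \<open>A bathtub argument. Split off from \<open>p\<close> its value \<open>f\<^sub>0 - a h\<close> at the distance \<open>h\<close> equal to half the
  length of the arc. What is left is at most \<open>a\<close> times the tent of half-width \<open>h\<close> around \<open>x\<close> on
  the torus, which has total mass \<open>a h\<^sup>2\<close>. For the midpoint this tent fits exactly into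
  the arc, so the bound is attained there. On the interval \<open>[-L, L)\<close> the tent of the
  torus is dominated by the sum of three translates by multiples of the circumference.\<close>

lemma reach_le:
  assumes x: "\<bar>x\<bar> \<le> m_L M"
    and arc: "- m_L M \<le> u" "u \<le> v" "v \<le> m_L M"
    and short: "a * ((v - u) / 2) \<le> f0"
  shows "(LBINT z:{u..<v}. p M x z) \<le> (v - u) * (f0 - a * (v - u) / 4)"
proof -
  define h where "h = (v - u) / 2"
  have h: "0 \<le> h" using arc by (simp add: h_def)
  let ?tents = "\<lambda>z. tent h (z - x - 2 * m_L M) + tent h (z - x) + tent h (z - x + 2 * m_L M)"
  have pointwise: "p M x z \<le> (f0 - a * h) + a * ?tents z" if z: "z \<in> {u..v}" for z
  proof -
    have z': "\<bar>z\<bar> \<le> m_L M" using z arc by auto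
    have "tdist M x z \<in> {\<bar>z - x - 2 * m_L M\<bar>, \<bar>z - x\<bar>, \<bar>z - x + 2 * m_L M\<bar>}"
      using x z' unfolding tdist_def min_def by (simp split: if_split) argo
    then have "max 0 (h - tdist M x z) \<in> {tent h (z - x - 2 * m_L M), tent h (z - x),
        tent h (z - x + 2 * m_L M)}"
      by (auto simp: tent_def)
    then have "max 0 (h - tdist M x z) \<le> ?tents z"
      using tent_nonneg[of h "z - x - 2 * m_L M"] tent_nonneg[of h "z - x"]
        tent_nonneg[of h "z - x + 2 * m_L M"] by auto
    then have "a * max 0 (h - tdist M x z) \<le> a * ?tents z"
      using a_pos by (intro mult_left_mono) auto
    moreover have "p M x z \<le> (f0 - a * h) + a * max 0 (h - tdist M x z)"
    proof (cases "tdist M x z \<le> h")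
      case True
      then have "a * tdist M x z \<le> a * h" using a_pos by simp
      moreover have "a * h \<le> f0" using short by (simp add: h_def)
      ultimately show ?thesis
        using True z' x by (simp add: p_eq algebra_simps)
    next
      case False
      then have "a * h \<le> a * tdist M x z" using a_pos by simp
      moreover have "a * h \<le> f0" using short by (simp add: h_def)
      ultimately show ?thesis
        using False z' x by (simp add: p_eq algebra_simps)
    qed
    ultimately show ?thesis by linarith
  qed
  have "(LBINT z:{u..<v}. p M x z) = integral {u..v} (p M x)"
    using x arc by (intro LBINT_Ico_eq_integral continuous_on_p) auto
  also have "\<dots> \<le> integral {u..v} (\<lambda>z. (f0 - a * h) + a * ?tents z)"
    using x arc by (intro integral_le pointwise integrable_continuous_real continuous_on_p
        continuous_intros) auto
  also have "\<dots> = 2 * h * (f0 - a * h) + a * integral {u..v} ?tents"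
    using arc by (subst integral_add; (intro integrable_continuous_real continuous_intros)?)
      (simp add: h_def)
  also have "\<dots> \<le> 2 * h * (f0 - a * h) + a * h\<^sup>2"
    using a_pos h arc integral_tent_periodised[of h u v "2 * m_L M" x]
    by (intro add_left_mono mult_left_mono) auto
  also have "\<dots> = (v - u) * (f0 - a * (v - u) / 4)"
    unfolding h_def by (simp add: field_simps power2_eq_square)
  finally show ?thesis .
qed

lemma reach_midpoint:
  assumes arc: "- m_L M \<le> u" "u \<le> v" "v \<le> m_L M"
    and short: "a * ((v - u) / 2) \<le> f0"
  shows "(LBINT z:{u..<v}. p M (midpoint u v) z) = (v - u) * (f0 - a * (v - u) / 4)"
proof -
  define h where "h = (v - u) / 2"
  define m where "m = midpoint u v"
  have uv: "u = m - h" "v = m + h"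
    by (simp_all add: h_def m_def midpoint_def field_simps)
  have m: "\<bar>m\<bar> \<le> m_L M" and h: "0 \<le> h" "a * h \<le> f0"
    using arc short by (auto simp: h_def m_def midpoint_def)
  have tent: "p M m z = (f0 - a * h) + a * tent h (z + - m)" if "z \<in> {u..v}" for z
  proof -
    have dist: "\<bar>m - z\<bar> \<le> h" "2 * h \<le> 2 * m_L M"
      using that arc uv by auto
    then have "a * \<bar>m - z\<bar> \<le> a * h" using a_pos by (intro mult_left_mono) auto
    moreover have "tdist M m z = \<bar>m - z\<bar>"
      using dist by (simp add: tdist_def)
    moreover have "\<bar>z\<bar> \<le> m_L M" using that arc by auto
    ultimately show ?thesis
      using dist h m
      by (simp add: p_eq tent_def abs_minus_commute[of z m] algebra_simps)
  qed
  have "(LBINT z:{u..<v}. p M m z) = integral {u..v} (p M m)"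
    using m arc by (intro LBINT_Ico_eq_integral continuous_on_p) auto
  also have "\<dots> = integral {u..v} (\<lambda>z. (f0 - a * h) + a * tent h (z + - m))"
    by (rule integral_cong) (rule tent)
  also have "\<dots> = 2 * h * (f0 - a * h) + a * integral {u..v} (\<lambda>z. tent h (z + - m))"
    using arc by (subst integral_add; (intro integrable_continuous_real continuous_intros)?)
      (simp add: h_def)
  also have "integral {u..v} (\<lambda>z. tent h (z + - m)) = h\<^sup>2"
    using integral_tent_shift[of u v h "- m"] has_integral_tent[of h "- h" h] h uv
    by (simp add: integral_unique)
  also have "2 * h * (f0 - a * h) + a * h\<^sup>2 = (v - u) * (f0 - a * (v - u) / 4)"
    unfolding h_def by (simp add: field_simps power2_eq_square)
  finally show ?thesis by (simp add: m_def)
qed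

section \<open>Utilities of the perturbed communities\<close>

text \<open>The three terms guarantee, in turn, that the communities stay too far apart for a boundary
  consumer of one to profit from the other, that the arcs of consumers do not become empty,
  and that \<open>p\<close> is not truncated at \<open>0\<close> between the midpoint of an arc and its ends.\<close>

definition margin :: real where
  "margin = min (LC - ld) (min ld (2 * m_c M / (a * g0)))"

definition near :: "perturbation \<Rightarrow> real \<Rightarrow> bool" where
  "near \<delta> t \<longleftrightarrow> \<bar>\<delta>dl \<delta> t\<bar> \<le> margin \<and> \<bar>\<delta>dr \<delta> t\<bar> \<le> margin \<and>
                \<bar>\<delta>sl \<delta> t\<bar> \<le> margin \<and> \<bar>\<delta>sr \<delta> t\<bar> \<le> margin"

lemma margin_pos: "0 < margin"
  using cost_pos a_pos g0_pos ld_pos ld_less by (simp add: margin_def)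

lemma margin_le: "margin \<le> LC - ld" "margin \<le> ld" "a * (ld + margin / 2) \<le> f0"
proof -
  show "margin \<le> LC - ld" "margin \<le> ld" by (auto simp: margin_def)
  have "margin \<le> 2 * m_c M / (a * g0)" by (auto simp: margin_def)
  then have "margin * (a * g0) \<le> 2 * (g0 * (f0 - a * ld))"
    using a_pos g0_pos by (simp add: pos_le_divide_eq break_even)
  then have "g0 * (margin * a) \<le> g0 * (2 * (f0 - a * ld))"
    by (simp add: algebra_simps)
  then have "margin * a \<le> 2 * (f0 - a * ld)" using g0_pos by simp
  then show "a * (ld + margin / 2) \<le> f0" by (simp add: algebra_simps)
qed

lemma near_audience:
  assumes "near \<delta> t"
  defines "u \<equiv> \<lambda>i. fst (ends_d LC ld \<delta> i t)" and "v \<equiv> \<lambda>i. snd (ends_d LC ld \<delta> i t)"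
  shows "- m_L M \<le> u i" "u i < v i" "v i \<le> m_L M" "a * ((v i - u i) / 2) \<le> f0"
    "\<bar>midpoint (u i) (v i)\<bar> < m_L M"
proof -
  show "- m_L M \<le> u i" "u i < v i" "v i \<le> m_L M"
    using assms(1) margin_le ld_pos ld_less two_LC_le
    by (cases i; auto simp: u_def v_def near_def)+
  have "(v i - u i) / 2 \<le> ld + margin / 2"
    using assms(1) by (cases i) (auto simp: u_def v_def near_def)
  then have "a * ((v i - u i) / 2) \<le> a * (ld + margin / 2)"
    using a_pos by (intro mult_left_mono) auto
  with margin_le show "a * ((v i - u i) / 2) \<le> f0" by linarith
  show "\<bar>midpoint (u i) (v i)\<bar> < m_L M"
    using assms(1) margin_le ld_pos ld_less two_LC_le
    by (cases i; auto simp: u_def v_def near_def midpoint_def field_simps)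
qed

lemma pert_topic_eq_midpoint:
  assumes near: "near \<delta> t" and y: "\<bar>y\<bar> \<le> m_L M"
  shows "pert_topic M LC ld \<delta> i t y
       = midpoint (fst (ends_d LC ld \<delta> i t)) (snd (ends_d LC ld \<delta> i t))"
proof -
  define u where "u = fst (ends_d LC ld \<delta> i t)"
  define v where "v = snd (ends_d LC ld \<delta> i t)"
  note aud = near_audience[OF near, of i, folded u_def v_def]
  have le: "q M x y * (LBINT z:{u..<v}. p M x z)
          \<le> q M (midpoint u v) y * (LBINT z:{u..<v}. p M (midpoint u v) z)"
    if "x \<in> agents M" for x
  proof -
    have x: "\<bar>x\<bar> \<le> m_L M" using that by (auto simp: agents_def)
    have "(LBINT z:{u..<v}. p M x z) \<le> (LBINT z:{u..<v}. p M (midpoint u v) z)"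
      using reach_le[OF x] reach_midpoint aud by simp
    then show ?thesis
      using g0_pos x y aud by (simp add: q_eq)
  qed
  have "midpoint u v \<in> agents M" using aud by (auto simp: agents_def)
  with le have "is_arg_max (\<lambda>x. q M x y * (LBINT z:{u..<v}. p M x z)) (\<lambda>x. x \<in> agents M)
      (midpoint u v)"
    by (simp add: is_arg_max_linorder)
  then show ?thesis
    by (simp add: pert_topic_def Let_def pert_C_d_def flip: u_def v_def)
qed

definition rate :: real where "rate = m_Ep M * m_Eq M * g0 * a"

lemma rate_pos: "0 < rate"
  using Ep_pos Eq_pos g0_pos a_pos by (simp add: rate_def)

lemma pert_U_s_eq:
  assumes near: "near \<delta> t" and y: "\<bar>y\<bar> \<le> m_L M"
  shows "pert_U_s M LC ld \<delta> Com1 t y = rate * (ld\<^sup>2 - (\<delta>dl \<delta> t)\<^sup>2 / 4)"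
    and "pert_U_s M LC ld \<delta> Com2 t y = rate * (ld\<^sup>2 - (\<delta>dr \<delta> t)\<^sup>2 / 4)"
proof -
  have general: "pert_U_s M LC ld \<delta> i t y = rate * (ld\<^sup>2 - ((v - u) / 2 - ld)\<^sup>2)"
    if uv: "u = fst (ends_d LC ld \<delta> i t)" "v = snd (ends_d LC ld \<delta> i t)" for i u v
  proof -
    note aud = near_audience[OF near, of i, folded uv]
    note topic = pert_topic_eq_midpoint[OF near y, of i, folded uv]
    have "set_integrable lborel {u..<v} (p M (midpoint u v))"
      by (rule set_integrable_subset[OF borel_integrable_atLeastAtMost'[of u v]])
        (use aud in \<open>auto intro!: continuous_on_p\<close>)
    then have p_int: "set_integrable lborel {u..<v} (\<lambda>z. g0 * p M (midpoint u v) z)"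
      by simp
    have "(LBINT z:{u..<v}. q M (midpoint u v) y * p M (midpoint u v) z - m_c M)
        = g0 * (LBINT z:{u..<v}. p M (midpoint u v) z) - (v - u) * m_c M"
      using aud y by (simp add: q_eq set_integral_diff(2)[OF p_int] set_integrable_def
          set_lebesgue_integral_def[of lborel "{u..<v}" "\<lambda>z. m_c M"])
    also have "\<dots> = g0 * ((v - u) * (f0 - a * (v - u) / 4)) - (v - u) * (g0 * (f0 - a * ld))"
      using aud by (subst reach_midpoint) (auto simp: break_even)
    also have "\<dots> = g0 * a * (ld\<^sup>2 - ((v - u) / 2 - ld)\<^sup>2)"
      by (simp add: field_simps power2_eq_square)
    finally show ?thesis
      using topic by (simp add: pert_U_s_def pert_C_d_def rate_def mult.assoc flip: uv)
  qed
  have excess: "(2 * ld + w) / 2 - ld = w / 2" "(2 * ld - w) / 2 - ld = - (w / 2)" for w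
    by argo+
  show "pert_U_s M LC ld \<delta> Com1 t y = rate * (ld\<^sup>2 - (\<delta>dl \<delta> t)\<^sup>2 / 4)"
    using general[OF refl refl, of Com1] by (simp add: excess power_divide)
  show "pert_U_s M LC ld \<delta> Com2 t y = rate * (ld\<^sup>2 - (\<delta>dr \<delta> t)\<^sup>2 / 4)"
    using general[OF refl refl, of Com2] by (simp add: excess power_divide)
qed

lemma pert_U_d_eq:
  assumes near: "near \<delta> t"
  shows "pert_U_d M LC ld \<delta> Com1 t y
       = m_Ep M * m_Eq M * (2 * LC + \<delta>sl \<delta> t) * (g0 * p M (- LC + \<delta>dl \<delta> t / 2) y - m_c M)"
    and "pert_U_d M LC ld \<delta> Com2 t y
       = m_Ep M * m_Eq M * (2 * LC - \<delta>sr \<delta> t) * (g0 * p M (LC + \<delta>dr \<delta> t / 2) y - m_c M)"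
proof -
  have general: "pert_U_d M LC ld \<delta> i t y = m_Ep M * m_Eq M * (w - s) * (g0 * p M m y - m_c M)"
    if sw: "s = fst (ends_s LC \<delta> i t)" "w = snd (ends_s LC \<delta> i t)"
      and m: "m = midpoint (fst (ends_d LC ld \<delta> i t)) (snd (ends_d LC ld \<delta> i t))"
    for i s w m
  proof -
    have producers: "- m_L M \<le> s" "s \<le> w" "w \<le> m_L M"
      using near margin_le ld_pos ld_less two_LC_le
      by (cases i; auto simp: sw near_def)+
    have "(LBINT z:{s..<w}. q M (pert_topic M LC ld \<delta> i t z) z
              * p M (pert_topic M LC ld \<delta> i t z) y - m_c M)
        = (LBINT z:{s..<w}. g0 * p M m y - m_c M)"
      using pert_topic_eq_midpoint[OF near] near_audience[OF near, of i] producers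
      by (intro set_lebesgue_integral_cong) (auto simp: q_eq m)
    also have "\<dots> = (w - s) * (g0 * p M m y - m_c M)"
      using producers by (subst LBINT_Ico_eq_integral) auto
    finally show ?thesis
      by (simp add: pert_U_d_def pert_C_s_def flip: sw)
  qed
  have "midpoint (- LC - ld) (- LC + ld + \<delta>dl \<delta> t) = - LC + \<delta>dl \<delta> t / 2"
    "midpoint (LC - ld + \<delta>dr \<delta> t) (LC + ld) = LC + \<delta>dr \<delta> t / 2"
    by (simp_all add: midpoint_def field_simps)
  then show "pert_U_d M LC ld \<delta> Com1 t y
       = m_Ep M * m_Eq M * (2 * LC + \<delta>sl \<delta> t) * (g0 * p M (- LC + \<delta>dl \<delta> t / 2) y - m_c M)"
    and "pert_U_d M LC ld \<delta> Com2 t y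
       = m_Ep M * m_Eq M * (2 * LC - \<delta>sr \<delta> t) * (g0 * p M (LC + \<delta>dr \<delta> t / 2) y - m_c M)"
    using general[OF refl refl refl, of Com1] general[OF refl refl refl, of Com2]
    by (simp_all add: add.commute)
qed

lemma profit_at_distance:
  assumes "\<bar>x\<bar> \<le> m_L M" "\<bar>y\<bar> \<le> m_L M" "\<bar>x - y\<bar> \<le> m_L M" "a * \<bar>x - y\<bar> \<le> f0"
  shows "g0 * p M x y - m_c M = g0 * a * (ld - \<bar>x - y\<bar>)"
proof -
  have "tdist M x y = \<bar>x - y\<bar>" using assms by (simp add: tdist_def)
  then show ?thesis
    using assms by (simp add: p_eq algebra_simps flip: break_even)
qed

text \<open>The upper bound on \<open>\<bar>x - y\<bar>\<close> says that \<open>y\<close> is out of reach the other way round the torus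
  too.\<close>

lemma no_profit_beyond:
  assumes "\<bar>x\<bar> \<le> m_L M" "\<bar>y\<bar> \<le> m_L M" "ld \<le> \<bar>x - y\<bar>" "\<bar>x - y\<bar> \<le> 2 * m_L M - ld"
  shows "g0 * p M x y - m_c M \<le> 0"
proof -
  have "a * ld \<le> a * tdist M x y"
    using assms a_pos by (intro mult_left_mono) (auto simp: tdist_def)
  moreover have "0 \<le> f0 - a * ld"
    using break_even cost_pos g0_pos by (metis less_le_not_le linorder_not_le mult_pos_neg)
  ultimately have "p M x y \<le> f0 - a * ld"
    using assms by (simp add: p_eq)
  then show ?thesis
    using g0_pos by (simp flip: break_even)
qed

section \<open>Evolution of the perturbation\<close>

text \<open>The midpoint of the consumers moves by half the displacement of the boundary, which puts the
  boundary consumers at distance \<open>l\<^sub>d + \<delta>\<^sub>d\<^sub>l / 2\<close>, respectively \<open>l\<^sub>d - \<delta>\<^sub>d\<^sub>r / 2\<close>, from the topic of their own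
  community. Both are at least \<open>l\<^sub>d\<close> away from the topic of the other one, so the maxima with \<open>0\<close>
  vanish.\<close>

lemma consumer_drift:
  assumes near: "near \<delta> t"
  defines "b \<equiv> - LC + ld + \<delta>dl \<delta> t" and "b' \<equiv> LC - ld + \<delta>dr \<delta> t"
  shows "pert_U_d M LC ld \<delta> Com1 t b - max 0 (pert_U_d M LC ld \<delta> Com2 t b)
       = - (rate / 2 * (2 * LC + \<delta>sl \<delta> t) * \<delta>dl \<delta> t)"
    and "max 0 (pert_U_d M LC ld \<delta> Com1 t b') - pert_U_d M LC ld \<delta> Com2 t b'
       = - (rate / 2 * (2 * LC - \<delta>sr \<delta> t) * \<delta>dr \<delta> t)"
proof -
  define m1 where "m1 = - LC + \<delta>dl \<delta> t / 2"
  define m2 where "m2 = LC + \<delta>dr \<delta> t / 2"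
  note m = m1_def m2_def
  note U = pert_U_d_eq[OF near, folded m]
  have small: "\<bar>\<delta>dl \<delta> t\<bar> \<le> margin" "\<bar>\<delta>dr \<delta> t\<bar> \<le> margin" "\<bar>\<delta>sl \<delta> t\<bar> \<le> margin" "\<bar>\<delta>sr \<delta> t\<bar> \<le> margin"
    using near by (auto simp: near_def)
  note bounds = small margin_le(1,2) ld_pos ld_less two_LC_le
  have mass: "0 \<le> m_Ep M * m_Eq M * (2 * LC + \<delta>sl \<delta> t)" "0 \<le> m_Ep M * m_Eq M * (2 * LC - \<delta>sr \<delta> t)"
    using bounds Ep_pos Eq_pos by auto
  have in_reach: "a * r \<le> f0" if "r \<le> ld + margin / 2" for r
    using margin_le(3) mult_left_mono[OF that, of a] a_pos by linarith
  have dist1: "\<bar>m1 - b\<bar> = ld + \<delta>dl \<delta> t / 2" and dist2: "\<bar>m2 - b'\<bar> = ld - \<delta>dr \<delta> t / 2"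
    using bounds by (auto simp: m b_def b'_def)
  have "g0 * p M (m1) b - m_c M = g0 * a * (ld - \<bar>m1 - b\<bar>)"
    using bounds by (intro profit_at_distance) (auto simp: dist1 intro!: in_reach, auto simp: m b_def)
  then have profit1: "g0 * p M (m1) b - m_c M = g0 * a * (- \<delta>dl \<delta> t / 2)"
    by (simp add: dist1)
  have "g0 * p M (m2) b' - m_c M = g0 * a * (ld - \<bar>m2 - b'\<bar>)"
    using bounds by (intro profit_at_distance) (auto simp: dist2 intro!: in_reach, auto simp: m b'_def)
  then have profit2: "g0 * p M (m2) b' - m_c M = g0 * a * (\<delta>dr \<delta> t / 2)"
    by (simp add: dist2)
  have "g0 * p M (m2) b - m_c M \<le> 0" "g0 * p M (m1) b' - m_c M \<le> 0"
    using bounds by (intro no_profit_beyond; simp add: m b_def b'_def)+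
  then have outside: "pert_U_d M LC ld \<delta> Com2 t b \<le> 0" "pert_U_d M LC ld \<delta> Com1 t b' \<le> 0"
    unfolding U using mass by (auto intro: mult_nonneg_nonpos)
  show "pert_U_d M LC ld \<delta> Com1 t b - max 0 (pert_U_d M LC ld \<delta> Com2 t b)
       = - (rate / 2 * (2 * LC + \<delta>sl \<delta> t) * \<delta>dl \<delta> t)"
    using outside(1) unfolding U(1) profit1 by (simp add: rate_def max_absorb1 field_simps)
  show "max 0 (pert_U_d M LC ld \<delta> Com1 t b') - pert_U_d M LC ld \<delta> Com2 t b'
       = - (rate / 2 * (2 * LC - \<delta>sr \<delta> t) * \<delta>dr \<delta> t)"
    using outside(2) unfolding U(2) profit2 by (simp add: rate_def max_absorb1 field_simps)
qed

text \<open>Both producer utilities are nonnegative near the equilibrium, so the maxima with \<open>0\<close> have no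
  effect and both boundaries move with the difference of the utilities.\<close>

lemma producer_drift:
  assumes near: "near \<delta> t" and y: "\<bar>y\<bar> \<le> m_L M"
  shows "pert_U_s M LC ld \<delta> Com1 t y - max 0 (pert_U_s M LC ld \<delta> Com2 t y)
       = rate / 4 * ((\<delta>dr \<delta> t)\<^sup>2 - (\<delta>dl \<delta> t)\<^sup>2)"
    and "max 0 (pert_U_s M LC ld \<delta> Com1 t y) - pert_U_s M LC ld \<delta> Com2 t y
       = rate / 4 * ((\<delta>dr \<delta> t)\<^sup>2 - (\<delta>dl \<delta> t)\<^sup>2)"
proof -
  have "(w / 2)\<^sup>2 \<le> ld\<^sup>2" if "\<bar>w\<bar> \<le> margin" for w
    using that margin_le(2) ld_pos by (intro power2_le_iff_abs_le[THEN iffD2]) auto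
  then have "(w)\<^sup>2 / 4 \<le> ld\<^sup>2" if "\<bar>w\<bar> \<le> margin" for w
    using that by (simp add: power_divide)
  then have "0 \<le> pert_U_s M LC ld \<delta> Com1 t y" "0 \<le> pert_U_s M LC ld \<delta> Com2 t y"
    using near rate_pos by (auto simp: pert_U_s_eq[OF near y] near_def)
  then show "pert_U_s M LC ld \<delta> Com1 t y - max 0 (pert_U_s M LC ld \<delta> Com2 t y)
       = rate / 4 * ((\<delta>dr \<delta> t)\<^sup>2 - (\<delta>dl \<delta> t)\<^sup>2)"
    and "max 0 (pert_U_s M LC ld \<delta> Com1 t y) - pert_U_s M LC ld \<delta> Com2 t y
       = rate / 4 * ((\<delta>dr \<delta> t)\<^sup>2 - (\<delta>dl \<delta> t)\<^sup>2)"
    by (simp_all add: pert_U_s_eq[OF near y] algebra_simps)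
qed

lemma evolution_while_near:
  assumes ev: "evolves M LC ld \<delta>" and near: "near \<delta> t" and t: "0 \<le> t"
  shows "(\<delta>dl \<delta> has_real_derivative - (rate / 2 * (2 * LC + \<delta>sl \<delta> t) * \<delta>dl \<delta> t)) (at t within {0..})"
    and "(\<delta>dr \<delta> has_real_derivative - (rate / 2 * (2 * LC - \<delta>sr \<delta> t) * \<delta>dr \<delta> t)) (at t within {0..})"
    and "(\<delta>sl \<delta> has_real_derivative rate / 4 * ((\<delta>dr \<delta> t)\<^sup>2 - (\<delta>dl \<delta> t)\<^sup>2)) (at t within {0..})"
    and "(\<delta>sr \<delta> has_real_derivative rate / 4 * ((\<delta>dr \<delta> t)\<^sup>2 - (\<delta>dl \<delta> t)\<^sup>2)) (at t within {0..})"
proof -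
  have site: "\<bar>- LC + ld + \<delta>sl \<delta> t\<bar> \<le> m_L M" "\<bar>LC - ld + \<delta>sr \<delta> t\<bar> \<le> m_L M"
    using near margin_le(1) ld_pos ld_less two_LC_le by (auto simp: near_def)
  note drift = consumer_drift[OF near] producer_drift(1)[OF near site(1)]
    producer_drift(2)[OF near site(2)]
  show "(\<delta>dl \<delta> has_real_derivative - (rate / 2 * (2 * LC + \<delta>sl \<delta> t) * \<delta>dl \<delta> t)) (at t within {0..})"
    "(\<delta>dr \<delta> has_real_derivative - (rate / 2 * (2 * LC - \<delta>sr \<delta> t) * \<delta>dr \<delta> t)) (at t within {0..})"
    "(\<delta>sl \<delta> has_real_derivative rate / 4 * ((\<delta>dr \<delta> t)\<^sup>2 - (\<delta>dl \<delta> t)\<^sup>2)) (at t within {0..})"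
    "(\<delta>sr \<delta> has_real_derivative rate / 4 * ((\<delta>dr \<delta> t)\<^sup>2 - (\<delta>dl \<delta> t)\<^sup>2)) (at t within {0..})"
    using ev[unfolded evolves_def, rule_format, OF t] unfolding drift by blast+
qed

text \<open>Starting within half the margin leaves room for the drift of the producer boundaries: with
  \<open>\<epsilon>\<close> for that half and \<open>\<kappa>\<close> for the rate of decay \<open>rate / 2 * LC\<close>, the squares of the consumer perturbations are at most \<open>\<epsilon>\<^sup>2 exp (- 2 \<kappa> t)\<close>, so
  the drift is at most \<open>\<epsilon>\<^sup>2 / (4 L\<^sub>C)\<close>, which is less than \<open>\<epsilon>\<close> since \<open>\<epsilon> \<le> L\<^sub>C / 2\<close>.\<close>

lemma trajectory_while_near:
  assumes ev: "evolves M LC ld \<delta>" and init: "small_initial (margin / 2) \<delta>"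
    and T: "0 \<le> T" and near: "\<And>t. \<lbrakk>0 \<le> t; t \<le> T\<rbrakk> \<Longrightarrow> near \<delta> t"
  shows "0 < \<delta>dl \<delta> T" "\<delta>dl \<delta> T \<le> margin / 2 * exp (- (rate / 2 * LC) * T)"
    and "0 < \<delta>dr \<delta> T" "\<delta>dr \<delta> T \<le> margin / 2 * exp (- (rate / 2 * LC) * T)"
    and "\<bar>\<delta>sl \<delta> T\<bar> < margin" "\<bar>\<delta>sr \<delta> T\<bar> < margin"
proof -
  define \<epsilon> where "\<epsilon> = margin / 2"
  define \<kappa> where "\<kappa> = rate / 2 * LC"
  have LC: "0 < LC" using ld_pos ld_less by linarith
  have \<epsilon>: "0 < \<epsilon>" "\<epsilon> \<le> LC / 2"
    using margin_pos margin_le(1) ld_pos by (auto simp: \<epsilon>_def)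
  have start: "0 < \<delta>dl \<delta> 0" "\<delta>dl \<delta> 0 \<le> \<epsilon>" "0 < \<delta>dr \<delta> 0" "\<delta>dr \<delta> 0 \<le> \<epsilon>"
    "\<bar>\<delta>sl \<delta> 0\<bar> \<le> \<epsilon>" "\<bar>\<delta>sr \<delta> 0\<bar> \<le> \<epsilon>"
    using init by (auto simp: small_initial_def \<epsilon>_def)
  have producers: "\<bar>\<delta>sl \<delta> t\<bar> \<le> LC" "\<bar>\<delta>sr \<delta> t\<bar> \<le> LC" if "0 \<le> t" "t \<le> T" for t
    using near[OF that] margin_le(1) ld_pos by (auto simp: near_def)
  have dl: "0 < \<delta>dl \<delta> t \<and> \<delta>dl \<delta> t \<le> \<delta>dl \<delta> 0 * exp (- \<kappa> * t)" if t: "0 \<le> t" "t \<le> T" for t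
  proof (rule exponential_decay[where x = "\<delta>dl \<delta>" and k = "\<lambda>s. rate / 2 * (2 * LC + \<delta>sl \<delta> s)",
        OF T _ _ start(1) t])
    fix s assume s: "0 \<le> s" "s \<le> T"
    show "(\<delta>dl \<delta> has_real_derivative - (rate / 2 * (2 * LC + \<delta>sl \<delta> s) * \<delta>dl \<delta> s))
        (at s within {0..})"
      by (rule evolution_while_near(1)[OF ev near[OF s] s(1)])
    have "LC \<le> 2 * LC + \<delta>sl \<delta> s" "2 * LC + \<delta>sl \<delta> s \<le> 3 * LC"
      using producers[OF s] by auto
    then show "\<kappa> \<le> rate / 2 * (2 * LC + \<delta>sl \<delta> s)
        \<and> rate / 2 * (2 * LC + \<delta>sl \<delta> s) \<le> rate / 2 * (3 * LC)"
      unfolding \<kappa>_def using rate_pos by (intro conjI mult_left_mono) auto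
  qed
  have dr: "0 < \<delta>dr \<delta> t \<and> \<delta>dr \<delta> t \<le> \<delta>dr \<delta> 0 * exp (- \<kappa> * t)" if t: "0 \<le> t" "t \<le> T" for t
  proof (rule exponential_decay[where x = "\<delta>dr \<delta>" and k = "\<lambda>s. rate / 2 * (2 * LC - \<delta>sr \<delta> s)",
        OF T _ _ start(3) t])
    fix s assume s: "0 \<le> s" "s \<le> T"
    show "(\<delta>dr \<delta> has_real_derivative - (rate / 2 * (2 * LC - \<delta>sr \<delta> s) * \<delta>dr \<delta> s))
        (at s within {0..})"
      by (rule evolution_while_near(2)[OF ev near[OF s] s(1)])
    have "LC \<le> 2 * LC - \<delta>sr \<delta> s" "2 * LC - \<delta>sr \<delta> s \<le> 3 * LC"
      using producers[OF s] by auto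
    then show "\<kappa> \<le> rate / 2 * (2 * LC - \<delta>sr \<delta> s)
        \<and> rate / 2 * (2 * LC - \<delta>sr \<delta> s) \<le> rate / 2 * (3 * LC)"
      unfolding \<kappa>_def using rate_pos by (intro conjI mult_left_mono) auto
  qed
  have decay: "0 < \<delta>dl \<delta> t" "\<delta>dl \<delta> t \<le> \<epsilon> * exp (- \<kappa> * t)"
      "0 < \<delta>dr \<delta> t" "\<delta>dr \<delta> t \<le> \<epsilon> * exp (- \<kappa> * t)" if t: "0 \<le> t" "t \<le> T" for t
    using dl[OF t] dr[OF t] mult_right_mono[OF start(2), of "exp (- \<kappa> * t)"]
      mult_right_mono[OF start(4), of "exp (- \<kappa> * t)"] exp_ge_zero[of "- \<kappa> * t"]
    by linarith+
  show "0 < \<delta>dl \<delta> T" "\<delta>dl \<delta> T \<le> margin / 2 * exp (- (rate / 2 * LC) * T)"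
    "0 < \<delta>dr \<delta> T" "\<delta>dr \<delta> T \<le> margin / 2 * exp (- (rate / 2 * LC) * T)"
    using decay[OF T order_refl] by (simp_all add: \<epsilon>_def \<kappa>_def)
  have speed: "\<bar>rate / 4 * ((\<delta>dr \<delta> t)\<^sup>2 - (\<delta>dl \<delta> t)\<^sup>2)\<bar> \<le> rate / 4 * \<epsilon>\<^sup>2 * exp (- (2 * \<kappa>) * t)"
    if t: "0 \<le> t" "t \<le> T" for t
  proof -
    have "(\<delta>dl \<delta> t)\<^sup>2 \<le> (\<epsilon> * exp (- \<kappa> * t))\<^sup>2" "(\<delta>dr \<delta> t)\<^sup>2 \<le> (\<epsilon> * exp (- \<kappa> * t))\<^sup>2"
      using decay[OF t] by (auto intro!: power_mono)
    then have "\<bar>(\<delta>dr \<delta> t)\<^sup>2 - (\<delta>dl \<delta> t)\<^sup>2\<bar> \<le> (\<epsilon> * exp (- \<kappa> * t))\<^sup>2"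
      using zero_le_power2[of "\<delta>dl \<delta> t"] zero_le_power2[of "\<delta>dr \<delta> t"] by linarith
    also have "\<dots> = \<epsilon>\<^sup>2 * exp (- (2 * \<kappa>) * t)"
      by (simp add: power_mult_distrib mult.assoc flip: exp_double)
    finally show ?thesis
      using rate_pos by (simp add: abs_mult mult_left_mono)
  qed
  have "0 < \<kappa>" using rate_pos LC by (simp add: \<kappa>_def)
  have "rate / 4 * \<epsilon>\<^sup>2 / (2 * \<kappa>) = \<epsilon> * (\<epsilon> / (4 * LC))"
    using rate_pos LC by (simp add: \<kappa>_def field_simps power2_eq_square)
  also have "\<dots> < \<epsilon> * 1"
    using \<epsilon> LC by (intro mult_strict_left_mono) (auto simp: field_simps)
  finally have drift_small: "rate / 4 * \<epsilon>\<^sup>2 / (2 * \<kappa>) < \<epsilon>" by simp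
  have "\<bar>\<delta>sl \<delta> T - \<delta>sl \<delta> 0\<bar> \<le> rate / 4 * \<epsilon>\<^sup>2 / (2 * \<kappa>)"
  proof (rule bounded_drift[OF T])
    fix t assume t: "0 \<le> t" "t \<le> T"
    show "\<exists>d. (\<delta>sl \<delta> has_real_derivative d) (at t within {0..})
        \<and> \<bar>d\<bar> \<le> rate / 4 * \<epsilon>\<^sup>2 * exp (- (2 * \<kappa>) * t)"
      using evolution_while_near(3)[OF ev near[OF t] t(1)] speed[OF t] by blast
  qed (use \<open>0 < \<kappa>\<close> rate_pos in auto)
  then show "\<bar>\<delta>sl \<delta> T\<bar> < margin"
    using drift_small start(5) by (simp add: \<epsilon>_def)
  have "\<bar>\<delta>sr \<delta> T - \<delta>sr \<delta> 0\<bar> \<le> rate / 4 * \<epsilon>\<^sup>2 / (2 * \<kappa>)"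
  proof (rule bounded_drift[OF T])
    fix t assume t: "0 \<le> t" "t \<le> T"
    show "\<exists>d. (\<delta>sr \<delta> has_real_derivative d) (at t within {0..})
        \<and> \<bar>d\<bar> \<le> rate / 4 * \<epsilon>\<^sup>2 * exp (- (2 * \<kappa>) * t)"
      using evolution_while_near(4)[OF ev near[OF t] t(1)] speed[OF t] by blast
  qed (use \<open>0 < \<kappa>\<close> rate_pos in auto)
  then show "\<bar>\<delta>sr \<delta> T\<bar> < margin"
    using drift_small start(6) by (simp add: \<epsilon>_def)
qed

text \<open>The four perturbations are bounded jointly: the decay of the consumer boundaries needs the
  producer boundaries to be close, and vice versa.\<close>

lemma near_forever:
  assumes ev: "evolves M LC ld \<delta>" and init: "small_initial (margin / 2) \<delta>" and t: "0 \<le> t"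
  shows "near \<delta> t"
proof -
  let ?r = "\<lambda>t. max (max \<bar>\<delta>dl \<delta> t\<bar> \<bar>\<delta>dr \<delta> t\<bar>) (max \<bar>\<delta>sl \<delta> t\<bar> \<bar>\<delta>sr \<delta> t\<bar>)"
  have near_iff: "near \<delta> s \<longleftrightarrow> ?r s \<le> margin" for s
    by (auto simp: near_def)
  have "continuous_on {0..} (\<delta>dl \<delta>)" "continuous_on {0..} (\<delta>dr \<delta>)"
    "continuous_on {0..} (\<delta>sl \<delta>)" "continuous_on {0..} (\<delta>sr \<delta>)"
    using ev unfolding evolves_def continuous_on_eq_continuous_within
    by (meson DERIV_continuous atLeast_iff)+
  then have cont: "continuous_on {0..} ?r"
    by (intro continuous_intros)
  have "?r t < margin"
  proof (rule bounded_by_continuation[OF cont _ _ t])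
    show "?r 0 < margin"
      using init margin_pos by (auto simp: small_initial_def)
    fix T :: real
    assume T: "0 \<le> T" and "\<And>t. \<lbrakk>0 \<le> t; t \<le> T\<rbrakk> \<Longrightarrow> ?r t \<le> margin"
    then have "\<And>t. \<lbrakk>0 \<le> t; t \<le> T\<rbrakk> \<Longrightarrow> near \<delta> t"
      by (simp add: near_iff)
    note traj = trajectory_while_near[OF ev init T this]
    have "margin / 2 * exp (- (rate / 2 * LC) * T) \<le> margin / 2 * 1"
      using margin_pos rate_pos ld_pos ld_less T by (intro mult_left_mono) auto
    with traj margin_pos have "\<bar>\<delta>dl \<delta> T\<bar> < margin" "\<bar>\<delta>dr \<delta> T\<bar> < margin"
      by linarith+
    with traj show "?r T < margin" by simp
  qed
  then show ?thesis by (simp add: near_iff)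
qed

theorem consumers_neutral_stable: "neutral_stable_d M LC ld"
  unfolding neutral_stable_d_def
proof (intro exI conjI allI impI)
  show "0 < margin / 2" using margin_pos by simp
  fix \<delta> assume *: "evolves M LC ld \<delta> \<and> admissible_initial LC ld \<delta> \<and> small_initial (margin / 2) \<delta>"
  then have ev: "evolves M LC ld \<delta>" and init: "small_initial (margin / 2) \<delta>" by auto
  note near = near_forever[OF ev init]
  define \<kappa> where "\<kappa> = rate / 2 * LC"
  have \<kappa>: "0 < \<kappa>" using rate_pos ld_pos ld_less by (simp add: \<kappa>_def)
  have dl: "0 < \<delta>dl \<delta> t" "\<delta>dl \<delta> t \<le> margin / 2 * exp (- \<kappa> * t)"
    and dr: "0 < \<delta>dr \<delta> t" "\<delta>dr \<delta> t \<le> margin / 2 * exp (- \<kappa> * t)" if "0 \<le> t" for t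
    using trajectory_while_near(1-4)[OF ev init that near] by (simp_all add: \<kappa>_def)
  have exp_le: "margin / 2 * exp (- \<kappa> * t) \<le> margin / 2" if "0 \<le> t" for t
    using that \<kappa> margin_pos by simp
  show "0 \<le> \<delta>dl \<delta> t" "\<delta>dl \<delta> t \<le> margin / 2" "0 \<le> \<delta>dr \<delta> t" "\<delta>dr \<delta> t \<le> margin / 2"
    if "0 \<le> t" for t
    using dl[OF that] dr[OF that] exp_le[OF that] by linarith+
  have "filterlim (\<lambda>t. - \<kappa> * t) at_bot at_top"
    using \<kappa> by (intro filterlim_tendsto_neg_mult_at_bot[OF tendsto_const _ filterlim_ident]) simp
  then have "((\<lambda>t. exp (- \<kappa> * t)) \<longlongrightarrow> 0) at_top"
    by (rule filterlim_compose[OF exp_at_bot])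
  then have vanish: "((\<lambda>t. margin / 2 * exp (- \<kappa> * t)) \<longlongrightarrow> 0) at_top"
    by (rule tendsto_mult_right_zero)
  have pos_time: "eventually (\<lambda>t. 0 \<le> t) (at_top :: real filter)"
    by (rule eventually_ge_at_top)
  show dl_lim: "(\<delta>dl \<delta> \<longlongrightarrow> 0) at_top"
    by (rule tendsto_sandwich[OF _ _ tendsto_const vanish];
        rule eventually_mono[OF pos_time]) (use dl in \<open>auto intro: less_imp_le\<close>)
  show dr_lim: "(\<delta>dr \<delta> \<longlongrightarrow> 0) at_top"
    by (rule tendsto_sandwich[OF _ _ tendsto_const vanish];
        rule eventually_mono[OF pos_time]) (use dr in \<open>auto intro: less_imp_le\<close>)
  show "\<forall>y \<in> {- 2 * LC ..< 0} \<union> {0 ..< 2 * LC}. \<exists>u>0.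
          ((\<lambda>t. pert_U_s M LC ld \<delta> Com1 t y) \<longlongrightarrow> u) at_top \<and>
          ((\<lambda>t. pert_U_s M LC ld \<delta> Com2 t y) \<longlongrightarrow> u) at_top"
  proof (intro ballI exI[of _ "rate * ld\<^sup>2"] conjI)
    show "0 < rate * ld\<^sup>2" using rate_pos ld_pos by simp
    fix y assume "y \<in> {- 2 * LC ..< 0} \<union> {0 ..< 2 * LC}"
    then have y: "\<bar>y\<bar> \<le> m_L M" using two_LC_le by auto
    have limit: "((\<lambda>t. rate * (ld\<^sup>2 - (w t)\<^sup>2 / 4)) \<longlongrightarrow> rate * ld\<^sup>2) at_top"
      if "(w \<longlongrightarrow> 0) at_top" for w :: "real \<Rightarrow> real"
      by (rule tendsto_eq_intros that refl | simp)+
    show "((\<lambda>t. pert_U_s M LC ld \<delta> Com1 t y) \<longlongrightarrow> rate * ld\<^sup>2) at_top"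
      by (rule Lim_transform_eventually[OF limit[OF dl_lim]], rule eventually_mono[OF pos_time])
        (simp add: pert_U_s_eq[OF near y])
    show "((\<lambda>t. pert_U_s M LC ld \<delta> Com2 t y) \<longlongrightarrow> rate * ld\<^sup>2) at_top"
      by (rule Lim_transform_eventually[OF limit[OF dr_lim]], rule eventually_mono[OF pos_time])
        (simp add: pert_U_s_eq[OF near y])
  qed
qed

end

theorem proposition5p2:
  fixes M :: content_model and f0 g0 a LC ld m0 :: real and N :: nat
  assumes "m_L M > 0" and "m_c M > 0" and "0 < m_Ep M" and "m_Ep M \<le> 1" and "m_Eq M > 0"
    and "0 < f0" and "f0 \<le> 1" and "0 < g0" and "g0 \<le> 1" and "a > 0"
    and "f0 * g0 > m_c M"
    and "\<forall>x\<ge>0. m_f M x = max 0 (f0 - a * x)"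
    and "\<forall>x\<ge>0. m_g M x = g0"
    and "N \<ge> 2" and "LC = m_L M / real N"
    and "ld = f0 / a - m_c M / (a * g0)" and "ld < LC"
    and "\<forall>k<N. m0 + 2 * LC * real k \<in> agents M"
    and "nash_equilibrium M (community_family M N m0 LC ld)"
  shows "neutral_stable M LC ld"
proof -
  have "ld = (f0 * g0 - m_c M) / (a * g0)"
    using assms(8,10,16) by (simp add: field_simps)
  then have "0 < ld"
    using assms(8,10,11) by simp
  moreover have "2 * LC \<le> m_L M"
  proof -
    have "LC * 2 \<le> LC * real N"
      using assms(14) \<open>0 < ld\<close> assms(17) by (intro mult_left_mono) auto
    moreover have "LC * real N = m_L M" using assms(14,15) by simp
    ultimately show ?thesis by linarith
  qed
  moreover have "g0 * (f0 - a * ld) = m_c M"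
    using assms(8,10,16) by (simp add: field_simps)
  ultimately interpret linear_market M f0 g0 a LC ld
    using assms by unfold_locales auto
  show ?thesis
    using consumers_neutral_stable by (simp add: neutral_stable_def)
qed

end
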